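(* Let $\gamma,\delta$ be constants with $\gamma+\delta\neq0$ and let $k$ be a nonzero constant. Consider the linear problem $$\psi_{n,y}=q_n\left(\gamma\phi_n+\delta\phi_{n+1}\right),\qquad \phi_{n+1}-\phi_n=r_n\psi_n, \qquad (\mathrm{A})$$ together with the time evolution $$k\psi_{n,t_2}=(\gamma+\delta)q_n\phi_{n,y}-(\gamma+\delta)\left(q_{n,y}-\delta q_nr_nq_n\right)\phi_n-\delta\left[\left(q_{n,y}r_n-q_nr_{n,y}\right)+(\gamma-\delta)\left(q_nr_n\right)^2\right]\psi_n,$$ $$k\phi_{n,t_2}=\phi_{n,yy}+(\gamma+\delta)v_n\phi_n. \qquad (\mathrm{B})$$ Then the compatibility conditions of the overdetermined linear systems (A) and (B) for $\psi_n$ and $\phi_n$ are equivalent to the system of differential-difference equations $$kq_{n,t_2}+q_{n,yy}+q_n\left(\gamma v_n+\delta v_{n+1}\right)+\gamma\delta\left(q_nr_n\right)^2q_n=0,$$ $$kr_{n,t_2}-r_{n,yy}-\left(\delta v_n+\gamma v_{n+1}\right)r_n-\gamma\delta\, r_n\left(q_nr_n\right)^2=0,$$ $$v_{n+1}-v_n=-2\left(r_nq_n\right)_y$$ (for all $n\in\mathbb{Z}$).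
   Context: Here $n\in\mathbb{Z}$ is a discrete variable, $y$ and $t_2$ are continuous variables, and subscripts $y,t_2$ denote partial differentiation. All functions are smooth in the continuous variables. For a fixed positive integer $M$: $q_n$ is an $M$-component row vector, $r_n$ an $M$-component column vector, $v_n$ an $M\times M$ matrix, $\psi_n$ a scalar and $\phi_n$ an $M$-component column vector; thus $q_nr_n$ and $q_n\phi_n$ are scalars and $r_nq_n$ is an $M\times M$ matrix. "Compatibility conditions" of (A) and (B) means the requirements $\psi_{n,yt_2}=\psi_{n,t_2y}$ and $(r_n\psi_n+\phi_n-\phi_{n+1})_{t_2}=0$ for all $n$, where all derivatives of $\psi$ with respect to $y,t_2$ and of $\phi$ with respect to $t_2$, and the shift $\phi_{n+1}$, are evaluated by means of (A) and (B), imposed for generic $\psi_n,\phi_n$: after using (A) and (B) to express everything linearly in $\psi_n$, $\phi_n$ and the $y$-derivatives of $\phi_n$, these quantities are regarded as independent, so each coefficient must vanish. *)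

theory Defs
  imports "HOL-Analysis.Analysis"
begin

text \<open>
  The linear problem is the pair of systems
  (A)  \<open>\<psi>\<^sub>n\<^sub>,\<^sub>y = q\<^sub>n (\<gamma> \<phi>\<^sub>n + \<delta> \<phi>\<^sub>n\<^sub>+\<^sub>1)\<close> and \<open>\<phi>\<^sub>n\<^sub>+\<^sub>1 - \<phi>\<^sub>n = r\<^sub>n \<psi>\<^sub>n\<close>;
  (B)  the evolution equations in \<open>t\<^sub>2\<close> for \<open>\<psi>\<^sub>n\<close> and \<open>\<phi>\<^sub>n\<close> (see \<open>psi_t\<close> and \<open>phi_evolution\<close> below).
  It has a row vector \<open>q\<^sub>n\<close>, a column vector \<open>r\<^sub>n\<close> and a square matrix \<open>v\<^sub>n\<close> as coefficients; \<open>\<psi>\<^sub>n\<close> is a scalar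
  and \<open>\<phi>\<^sub>n\<close> a column vector.

  Scalars range over a type of class \<^class>\<open>real_normed_field\<close>, which covers the real and the complex
  numbers. The argument order of all coefficient functions is \<open>f n y t\<close> with \<open>t\<close> standing for
  \<open>t\<^sub>2\<close>; row and column vectors are both of type \<open>'a ^ 'm\<close>, where \<open>M = CARD('m)\<close>.
\<close>

section \<open>Functions of the two continuous variables\<close>

definition pdy :: "(real \<Rightarrow> real \<Rightarrow> 'b::real_normed_vector) \<Rightarrow> real \<Rightarrow> real \<Rightarrow> 'b" where
  "pdy f y t = vector_derivative (\<lambda>s. f s t) (at y)"

definition pdt :: "(real \<Rightarrow> real \<Rightarrow> 'b::real_normed_vector) \<Rightarrow> real \<Rightarrow> real \<Rightarrow> 'b" where
  "pdt f y t = vector_derivative (\<lambda>s. f y s) (at t)"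

fun C_diff :: "nat \<Rightarrow> (real \<Rightarrow> real \<Rightarrow> 'b::real_normed_vector) \<Rightarrow> bool" where
  "C_diff 0 f \<longleftrightarrow> continuous_on UNIV (\<lambda>(y, t). f y t)"
| "C_diff (Suc k) f \<longleftrightarrow>
     continuous_on UNIV (\<lambda>(y, t). f y t) \<and>
     (\<forall>y t. (\<lambda>s. f s t) differentiable (at y)) \<and> (\<forall>y t. (\<lambda>s. f y s) differentiable (at t)) \<and>
     C_diff k (pdy f) \<and> C_diff k (pdt f)"

definition smooth :: "(real \<Rightarrow> real \<Rightarrow> 'b::real_normed_vector) \<Rightarrow> bool" where
  "smooth f \<longleftrightarrow> (\<forall>k. C_diff k f)"

section \<open>Products of row and column vectors\<close>

text \<open>\<open>q \<odot> x\<close> is the matrix product of a row and a column: bilinear, also over the complex numbers.\<close>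

definition row_col :: "'a::comm_semiring_1 ^ 'm \<Rightarrow> 'a ^ 'm \<Rightarrow> 'a" (infixl "\<odot>" 75) where
  "q \<odot> x = (\<Sum>i\<in>UNIV. q $ i * x $ i)"

definition col_row :: "'a::comm_semiring_1 ^ 'm \<Rightarrow> 'a ^ 'm \<Rightarrow> 'a ^ 'm ^ 'm" where
  "col_row r q = (\<chi> i j. r $ i * q $ j)"

section \<open>Expressions in the independent quantities\<close>

text \<open>
  At a site \<open>n\<close>, once (A) and (B) are used, everything becomes an expression, linear in the quantities
  \<open>\<psi>\<^sub>n\<close> and \<open>\<partial>\<^sub>y\<^sup>j \<phi>\<^sub>n\<close> for \<open>j = 0, 1, 2, \<dots>\<close>, with coefficients depending on \<open>(y, t)\<close>. Such an expression is a
  function \<open>L y t \<psi> \<phi>\<close>, where \<open>\<psi>\<close> is the value of \<open>\<psi>\<^sub>n\<close> and \<open>\<phi> j\<close> is the value of \<open>\<partial>\<^sub>y\<^sup>j \<phi>\<^sub>n\<close>. These values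
  are independent variables, so two expressions agree iff they agree for all \<open>\<psi>\<close> and \<open>\<phi>\<close>, that is, iff
  their coefficients agree.
\<close>

type_synonym ('a, 'm, 'b) expr = "real \<Rightarrow> real \<Rightarrow> 'a \<Rightarrow> (nat \<Rightarrow> 'a ^ 'm) \<Rightarrow> 'b"

text \<open>
  Total derivatives by the product rule. In both definitions the first summand differentiates the
  coefficients of \<open>L\<close>. The second one replaces \<open>\<psi>\<^sub>n\<close> and all \<open>\<partial>\<^sub>y\<^sup>j \<phi>\<^sub>n\<close> by their own derivatives (since \<open>L\<close> is
  linear in them): \<open>\<partial>\<^sub>y\<close> sends \<open>\<psi>\<^sub>n\<close> to the given expression \<open>P\<close> for \<open>\<psi>\<^sub>n\<^sub>,\<^sub>y\<close> and \<open>\<partial>\<^sub>y\<^sup>j \<phi>\<^sub>n\<close> to \<open>\<partial>\<^sub>y\<^sup>j\<^sup>+\<^sup>1 \<phi>\<^sub>n\<close>; \<open>\<partial>\<^sub>t\<close> sends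
  \<open>\<psi>\<^sub>n\<close> to the given expression \<open>Q\<close> for \<open>\<psi>\<^sub>n\<^sub>,\<^sub>t\<close> and \<open>\<partial>\<^sub>y\<^sup>j \<phi>\<^sub>n\<close> to the \<open>j\<close>-th \<open>y\<close>-derivative of the given expression
  \<open>F\<close> for \<open>\<phi>\<^sub>n\<^sub>,\<^sub>t\<close>.
\<close>

definition total_y ::
  "('a, 'm, 'a) expr \<Rightarrow> ('a, 'm, 'b::real_normed_vector) expr \<Rightarrow> ('a, 'm, 'b) expr" where
  "total_y P L = (\<lambda>y t \<psi> \<phi>. pdy (\<lambda>y t. L y t \<psi> \<phi>) y t + L y t (P y t \<psi> \<phi>) (\<lambda>j. \<phi> (Suc j)))"

definition total_t ::
  "('a, 'm, 'a) expr \<Rightarrow> ('a, 'm, 'a) expr \<Rightarrow> ('a::real_normed_vector, 'm, 'a ^ 'm) expr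
     \<Rightarrow> ('a, 'm, 'b::real_normed_vector) expr \<Rightarrow> ('a, 'm, 'b) expr" where
  "total_t P Q F L = (\<lambda>y t \<psi> \<phi>. pdt (\<lambda>y t. L y t \<psi> \<phi>) y t
     + L y t (Q y t \<psi> \<phi>) (\<lambda>j. (total_y P ^^ j) F y t \<psi> \<phi>))"

section \<open>The linear problem\<close>

text \<open>
  The arguments \<open>q\<close>, \<open>r\<close>, \<open>v\<close> are the coefficients at one site. The shift \<open>\<phi>\<^sub>n\<^sub>+\<^sub>1\<close> and \<open>\<psi>\<^sub>n\<^sub>,\<^sub>y\<close> are obtained from (A).
\<close>

definition phi_cur :: "('a, 'm, 'a ^ 'm) expr" where
  "phi_cur y t \<psi> \<phi> = \<phi> 0"

definition phi_next ::
  "(real \<Rightarrow> real \<Rightarrow> 'a ^ 'm) \<Rightarrow> ('a::real_normed_field, 'm, 'a ^ 'm) expr" where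
  "phi_next r y t \<psi> \<phi> = \<phi> 0 + \<psi> *s r y t"

definition psi_y ::
  "'a \<Rightarrow> 'a \<Rightarrow> (real \<Rightarrow> real \<Rightarrow> 'a ^ 'm) \<Rightarrow> (real \<Rightarrow> real \<Rightarrow> 'a ^ 'm)
     \<Rightarrow> ('a::real_normed_field, 'm, 'a) expr" where
  "psi_y \<gamma> \<delta> q r y t \<psi> \<phi> = q y t \<odot> (\<gamma> *s phi_cur y t \<psi> \<phi> + \<delta> *s phi_next r y t \<psi> \<phi>)"

definition psi_t ::
  "'a \<Rightarrow> 'a \<Rightarrow> 'a \<Rightarrow> (real \<Rightarrow> real \<Rightarrow> 'a ^ 'm) \<Rightarrow> (real \<Rightarrow> real \<Rightarrow> 'a ^ 'm)
     \<Rightarrow> ('a::real_normed_field, 'm, 'a) expr" where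
  "psi_t \<gamma> \<delta> k q r y t \<psi> \<phi> = (1 / k) *
     ((\<gamma> + \<delta>) * (q y t \<odot> \<phi> 1)
      - (\<gamma> + \<delta>) * ((pdy q y t - (\<delta> * (q y t \<odot> r y t)) *s q y t) \<odot> \<phi> 0)
      - \<delta> * ((pdy q y t \<odot> r y t - q y t \<odot> pdy r y t) + (\<gamma> - \<delta>) * (q y t \<odot> r y t)\<^sup>2) * \<psi>)"

text \<open>
  The evolution of \<open>\<phi>\<close> in (B), applied to an expression \<open>X\<close>: it is needed for \<open>X = \<phi>\<^sub>n\<close> with \<open>v = v\<^sub>n\<close>, and for
  \<open>X = \<phi>\<^sub>n\<^sub>+\<^sub>1\<close> (written in the quantities at site \<open>n\<close>) with \<open>v = v\<^sub>n\<^sub>+\<^sub>1\<close>.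
\<close>

definition phi_evolution ::
  "('a, 'm, 'a) expr \<Rightarrow> 'a \<Rightarrow> 'a \<Rightarrow> 'a \<Rightarrow> (real \<Rightarrow> real \<Rightarrow> 'a ^ 'm ^ 'm)
     \<Rightarrow> ('a, 'm, 'a ^ 'm) expr \<Rightarrow> ('a::real_normed_field, 'm, 'a ^ 'm) expr" where
  "phi_evolution P \<gamma> \<delta> k v X y t \<psi> \<phi> =
     (1 / k) *s (total_y P (total_y P X) y t \<psi> \<phi> + (\<gamma> + \<delta>) *s (v y t *v X y t \<psi> \<phi>))"

text \<open>
  The conditions \<open>\<psi>\<^sub>n\<^sub>,\<^sub>y\<^sub>t = \<psi>\<^sub>n\<^sub>,\<^sub>t\<^sub>y\<close> and \<open>(r\<^sub>n \<psi>\<^sub>n + \<phi>\<^sub>n - \<phi>\<^sub>n\<^sub>+\<^sub>1)\<^sub>t = 0\<close>. In the second one the time derivative of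
  \<open>\<phi>\<^sub>n\<^sub>+\<^sub>1\<close> has to come from (B) at site \<open>n + 1\<close>: differentiating the expression \<open>phi_next\<close> instead would make the
  condition void.
\<close>

definition compatible ::
  "'a \<Rightarrow> 'a \<Rightarrow> 'a \<Rightarrow> (int \<Rightarrow> real \<Rightarrow> real \<Rightarrow> 'a ^ 'm) \<Rightarrow> (int \<Rightarrow> real \<Rightarrow> real \<Rightarrow> 'a ^ 'm)
     \<Rightarrow> (int \<Rightarrow> real \<Rightarrow> real \<Rightarrow> 'a::real_normed_field ^ 'm ^ 'm) \<Rightarrow> bool" where
  "compatible \<gamma> \<delta> k q r v \<longleftrightarrow> (\<forall>n y t \<psi> \<phi>.
     (let P = psi_y \<gamma> \<delta> (q n) (r n);
          Q = psi_t \<gamma> \<delta> k (q n) (r n);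
          F = phi_evolution P \<gamma> \<delta> k (v n) phi_cur;
          F_next = phi_evolution P \<gamma> \<delta> k (v (n + 1)) (phi_next (r n))
      in total_t P Q F P y t \<psi> \<phi> = total_y P Q y t \<psi> \<phi> \<and>
         total_t P Q F (\<lambda>y t \<psi> \<phi>. \<psi> *s r n y t + phi_cur y t \<psi> \<phi>) y t \<psi> \<phi> - F_next y t \<psi> \<phi> = 0))"

end

theory Submission
  imports Defs
begin

text \<open>
  All terms in \<open>\<phi>\<^sub>n\<^sub>,\<^sub>y\<close> and \<open>\<phi>\<^sub>n\<^sub>,\<^sub>y\<^sub>y\<close> cancel in the two compatibility conditions. The coefficient of \<open>\<phi>\<^sub>n\<close>
  in the second condition gives the equation for \<open>v\<^sub>n\<^sub>+\<^sub>1 - v\<^sub>n\<close>; modulo it, the coefficient of \<open>\<phi>\<^sub>n\<close> in the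
  first one is the equation for \<open>q\<^sub>n\<close> and the coefficient of \<open>\<psi>\<^sub>n\<close> in the second one is the equation for
  \<open>r\<^sub>n\<close>. The remaining coefficient, that of \<open>\<psi>\<^sub>n\<close> in the first condition, is \<open>\<delta>\<close> times a conservation law for
  \<open>q\<^sub>n r\<^sub>n\<close>. It is redundant: multiply the equation for \<open>q\<^sub>n\<close> by \<open>r\<^sub>n\<close> from the right, the one for \<open>r\<^sub>n\<close> by \<open>q\<^sub>n\<close>
  from the left, add, and use the equation for \<open>v\<^sub>n\<^sub>+\<^sub>1 - v\<^sub>n\<close>.
\<close>

section \<open>Bilinear algebra of rows and columns\<close>

lemma row_col_add_left: "(a + b) \<odot> x = a \<odot> x + b \<odot> x"
  and row_col_add_right: "a \<odot> (x + y) = a \<odot> x + a \<odot> y"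
  and row_col_smult_left: "(c *s a) \<odot> x = c * (a \<odot> x)"
  and row_col_smult_right: "a \<odot> (c *s x) = c * (a \<odot> x)"
  and row_col_zero_left: "0 \<odot> x = 0"
  and row_col_zero_right: "a \<odot> 0 = 0"
  by (simp_all add: row_col_def sum.distrib sum_distrib_left algebra_simps)

lemma row_col_diff_left: "((a :: 'a::comm_ring_1 ^ 'm) - b) \<odot> x = a \<odot> x - b \<odot> x"
  and row_col_diff_right: "(a :: 'a::comm_ring_1 ^ 'm) \<odot> (x - y) = a \<odot> x - a \<odot> y"
  by (simp_all add: row_col_def sum_subtractf algebra_simps)

lemmas row_col_simps = row_col_add_left row_col_add_right row_col_smult_left row_col_smult_right
  row_col_zero_left row_col_zero_right row_col_diff_left row_col_diff_right

lemma row_col_axis: "a \<odot> axis i 1 = a $ i"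
  by (simp add: row_col_def axis_def if_distrib cong: if_cong)

lemma row_col_matrix_vector: "a \<odot> (A *v x) = (a v* A) \<odot> x"
  unfolding row_col_def matrix_vector_mult_def vector_matrix_mult_def
  by (simp add: sum_distrib_left sum_distrib_right mult.assoc) (rule sum.swap)

lemma col_row_matrix_vector: "col_row r a *v x = (a \<odot> x) *s r"
  by (simp add: vec_eq_iff col_row_def matrix_vector_mult_def row_col_def sum_distrib_left
      sum_distrib_right mult_ac)

lemma vector_matrix_col_row: "a v* col_row r b = (a \<odot> r) *s b"
  by (simp add: vec_eq_iff col_row_def vector_matrix_mult_def row_col_def sum_distrib_left
      sum_distrib_right mult_ac)

text \<open>On a matrix, \<open>*s\<close> would expect a scalar of the row type and
  \<open>*\<^sub>R\<close> a real one, so the multiple of a matrix by a field element is written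
  \<open>mat c ** A\<close>.\<close>

lemma mat_matrix_mult: "mat c ** A = (\<chi> i j. c * A $ i $ j)" for A :: "'a::comm_semiring_1 ^ 'n ^ 'm"
  by (simp add: vec_eq_iff matrix_matrix_mult_def mat_def if_distrib[where f = "\<lambda>x. x * _"]
      cong: if_cong)

lemma mat_mult_matrix_vector: "(mat c ** A) *v x = c *s (A *v x)"
  for A :: "'a::comm_semiring_1 ^ 'n ^ 'm"
  unfolding mat_matrix_mult
  by (simp add: vec_eq_iff matrix_vector_mult_def sum_distrib_left mult.assoc)

lemma vector_matrix_mat_mult: "x v* (mat c ** A) = c *s (x v* A)"
  for A :: "'a::comm_semiring_1 ^ 'n ^ 'm"
  unfolding mat_matrix_mult
  by (simp add: vec_eq_iff vector_matrix_mult_def sum_distrib_left mult_ac)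

text \<open>The factor 2 in the equation for \<open>v\<close> is a real scaling of matrices; applied
  to vectors it becomes the scaling \<open>*s\<close> used in the other coefficients.\<close>

lemma scaleR_2_matrix_vector: "(2 *\<^sub>R A) *v x = 2 *s (A *v x)"
  and vector_matrix_scaleR_2: "z v* (2 *\<^sub>R A) = 2 *s (z v* A)"
  for A :: "'a::real_normed_field ^ 'n ^ 'm"
  by (simp_all add: vec_eq_iff matrix_vector_mult_def vector_matrix_mult_def sum_distrib_left
      scaleR_conv_of_real mult_ac)

section \<open>Partial derivatives\<close>

text \<open>The derivative is a limit of quotients, and limits of vectors may be taken
  componentwise. This reduces \<open>*s\<close> and \<open>col_row\<close> to the product rule for
  scalars.\<close>

lemma has_vector_derivative_vecI:
  fixes f :: "real \<Rightarrow> 'b::real_normed_vector ^ 'n"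
  assumes "\<And>i. ((\<lambda>s. f s $ i) has_vector_derivative f' $ i) (at x)"
  shows "(f has_vector_derivative f') (at x)"
  using assms unfolding has_vector_derivative_def has_derivative_def
  by (auto intro!: vec_tendstoI bounded_linear_scaleR_left)

lemma has_vector_derivative_vec_nth:
  "(f has_vector_derivative f') F \<Longrightarrow> ((\<lambda>s. f s $ i) has_vector_derivative f' $ i) F"
  by (rule bounded_linear.has_vector_derivative[OF bounded_linear_vec_nth])

lemma has_vector_derivative_row_col:
  fixes a x :: "real \<Rightarrow> 'a::real_normed_field ^ 'm"
  assumes "(a has_vector_derivative a') (at y)" "(x has_vector_derivative x') (at y)"
  shows "((\<lambda>s. a s \<odot> x s) has_vector_derivative a y \<odot> x' + a' \<odot> x y) (at y)"
  unfolding row_col_def sum.distrib[symmetric]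
  by (intro has_vector_derivative_sum has_vector_derivative_mult has_vector_derivative_vec_nth assms)

lemma has_vector_derivative_smult:
  fixes x :: "real \<Rightarrow> 'a::real_normed_field ^ 'm"
  assumes "(a has_vector_derivative a') (at y)" "(x has_vector_derivative x') (at y)"
  shows "((\<lambda>s. a s *s x s) has_vector_derivative a y *s x' + a' *s x y) (at y)"
  by (rule has_vector_derivative_vecI)
    (simp, intro has_vector_derivative_mult has_vector_derivative_vec_nth assms)

lemma has_vector_derivative_col_row:
  fixes a x :: "real \<Rightarrow> 'a::real_normed_field ^ 'm"
  assumes "(a has_vector_derivative a') (at y)" "(x has_vector_derivative x') (at y)"
  shows "((\<lambda>s. col_row (a s) (x s)) has_vector_derivative col_row (a y) x' + col_row a' (x y)) (at y)"
  by (intro has_vector_derivative_vecI)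
    (simp add: col_row_def, intro has_vector_derivative_mult has_vector_derivative_vec_nth assms)

lemmas has_vector_derivative_bilinear = has_vector_derivative_row_col has_vector_derivative_smult
  has_vector_derivative_col_row

lemma pdy_eqI: "((\<lambda>s. f s t) has_vector_derivative f') (at y) \<Longrightarrow> pdy f y t = f'"
  by (simp add: pdy_def vector_derivative_at)

lemma pdt_eqI: "((\<lambda>s. f y s) has_vector_derivative f') (at t) \<Longrightarrow> pdt f y t = f'"
  by (simp add: pdt_def vector_derivative_at)

lemma pdy_const: "pdy (\<lambda>y t. c) y t = 0"
  by (rule pdy_eqI) simp

lemma smooth_has_pdy: "smooth f \<Longrightarrow> ((\<lambda>s. f s t) has_vector_derivative pdy f y t) (at y)"
  unfolding smooth_def pdy_def by (metis C_diff.simps(2) vector_derivative_works)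

lemma smooth_has_pdt: "smooth f \<Longrightarrow> ((\<lambda>s. f y s) has_vector_derivative pdt f y t) (at t)"
  unfolding smooth_def pdt_def by (metis C_diff.simps(2) vector_derivative_works)

lemma smooth_pdy: "smooth f \<Longrightarrow> smooth (pdy f)"
  unfolding smooth_def by (metis C_diff.simps(2))

section \<open>Coefficients of the compatibility conditions\<close>

text \<open>The coefficient of \<open>\<phi>\<^sub>n\<close> in the first condition, up to the
  factor \<open>(\<gamma> + \<delta>) / k\<close>. That condition involves a single site, so
  \<open>v\<^sub>n\<^sub>+\<^sub>1\<close> is absent.\<close>

definition q_coeff :: "'a \<Rightarrow> 'a \<Rightarrow> 'a \<Rightarrow> (real \<Rightarrow> real \<Rightarrow> 'a ^ 'm) \<Rightarrow> (real \<Rightarrow> real \<Rightarrow> 'a ^ 'm)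
    \<Rightarrow> (real \<Rightarrow> real \<Rightarrow> 'a ^ 'm ^ 'm) \<Rightarrow> real \<Rightarrow> real \<Rightarrow> 'a::real_normed_field ^ 'm" where
  "q_coeff \<gamma> \<delta> k q r v y t =
     k *s pdt q y t + pdy (pdy q) y t + (\<gamma> + \<delta>) *s (q y t v* v y t)
     - (2 * \<delta>) *s ((q y t \<odot> r y t) *s pdy q y t + (q y t \<odot> pdy r y t) *s q y t)
     + (\<gamma> * \<delta> * (q y t \<odot> r y t)\<^sup>2) *s q y t"

text \<open>The potential \<open>v'\<close> stands for \<open>v\<^sub>n\<^sub>+\<^sub>1\<close>: it
  enters through (B) at site n + 1, acting on the part \<open>\<psi>\<^sub>n r\<^sub>n\<close> of
  \<open>\<phi>\<^sub>n\<^sub>+\<^sub>1\<close>.\<close>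

definition r_coeff :: "'a \<Rightarrow> 'a \<Rightarrow> 'a \<Rightarrow> (real \<Rightarrow> real \<Rightarrow> 'a ^ 'm) \<Rightarrow> (real \<Rightarrow> real \<Rightarrow> 'a ^ 'm)
    \<Rightarrow> (real \<Rightarrow> real \<Rightarrow> 'a ^ 'm ^ 'm) \<Rightarrow> real \<Rightarrow> real \<Rightarrow> 'a::real_normed_field ^ 'm" where
  "r_coeff \<gamma> \<delta> k q r v' y t =
     k *s pdt r y t - pdy (pdy r) y t - (\<gamma> + \<delta>) *s (v' y t *v r y t)
     - (2 * \<delta>) *s ((q y t \<odot> r y t) *s pdy r y t + (pdy q y t \<odot> r y t) *s r y t)
     - (\<gamma> * \<delta> * (q y t \<odot> r y t)\<^sup>2) *s r y t"

definition v_coeff :: "(real \<Rightarrow> real \<Rightarrow> 'a ^ 'm) \<Rightarrow> (real \<Rightarrow> real \<Rightarrow> 'a ^ 'm)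
    \<Rightarrow> (real \<Rightarrow> real \<Rightarrow> 'a ^ 'm ^ 'm) \<Rightarrow> (real \<Rightarrow> real \<Rightarrow> 'a ^ 'm ^ 'm)
    \<Rightarrow> real \<Rightarrow> real \<Rightarrow> 'a::real_normed_field ^ 'm ^ 'm" where
  "v_coeff q r v v' y t =
     v' y t - v y t + 2 *\<^sub>R (col_row (r y t) (pdy q y t) + col_row (pdy r y t) (q y t))"

text \<open>The expanded left side of the conservation law \<open>k (q r)_t + (q_y r - q r_y)_y +
  (\<gamma> - \<delta>) ((q r)^2)_y = 0\<close>.\<close>

definition qr_coeff :: "'a \<Rightarrow> 'a \<Rightarrow> 'a \<Rightarrow> (real \<Rightarrow> real \<Rightarrow> 'a ^ 'm) \<Rightarrow> (real \<Rightarrow> real \<Rightarrow> 'a ^ 'm)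
    \<Rightarrow> real \<Rightarrow> real \<Rightarrow> 'a::real_normed_field" where
  "qr_coeff \<gamma> \<delta> k q r y t =
     k * (q y t \<odot> pdt r y t + pdt q y t \<odot> r y t)
     + (pdy (pdy q) y t \<odot> r y t - q y t \<odot> pdy (pdy r) y t)
     + 2 * (\<gamma> - \<delta>) * (q y t \<odot> r y t) * (q y t \<odot> pdy r y t + pdy q y t \<odot> r y t)"

section \<open>Coefficient derivatives of \<open>psi_y\<close> and \<open>psi_t\<close>\<close>

lemma psi_y_alt:
  "psi_y \<gamma> \<delta> q r y t \<psi> \<phi> = (\<gamma> + \<delta>) * (q y t \<odot> \<phi> 0) + \<delta> * (q y t \<odot> r y t) * \<psi>"
  by (simp add: psi_y_def phi_cur_def phi_next_def row_col_simps algebra_simps)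

context
  fixes \<gamma> \<delta> k :: "'a::real_normed_field"
    and q r :: "real \<Rightarrow> real \<Rightarrow> 'a ^ 'm"
  assumes k: "k \<noteq> 0" and q: "smooth q" and r: "smooth r"
begin

lemmas qr_derivs = smooth_has_pdy[OF q] smooth_has_pdy[OF r] smooth_has_pdt[OF q] smooth_has_pdt[OF r]
  smooth_has_pdy[OF smooth_pdy[OF q]] smooth_has_pdy[OF smooth_pdy[OF r]]

lemma has_vector_derivative_psi_y:
  "((\<lambda>s. psi_y \<gamma> \<delta> q r s t \<psi> \<phi>) has_vector_derivative
     (\<gamma> + \<delta>) * (pdy q y t \<odot> \<phi> 0) + \<delta> * (q y t \<odot> pdy r y t + pdy q y t \<odot> r y t) * \<psi>) (at y)"
  unfolding psi_y_alt
  \<comment> \<open>The product rules build a derivative in their own shape; its equality with the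
    stated one is left to \<open>simp\<close>.\<close>
  by (rule has_vector_derivative_eq_rhs)
    (rule derivative_intros has_vector_derivative_bilinear qr_derivs
      has_vector_derivative_const | simp add: row_col_simps)+

lemma pdt_psi_y:
  "pdt (\<lambda>y t. psi_y \<gamma> \<delta> q r y t \<psi> \<phi>) y t =
     (\<gamma> + \<delta>) * (pdt q y t \<odot> \<phi> 0) + \<delta> * (q y t \<odot> pdt r y t + pdt q y t \<odot> r y t) * \<psi>"
  unfolding psi_y_alt
  by (rule pdt_eqI, rule has_vector_derivative_eq_rhs)
    (rule derivative_intros has_vector_derivative_bilinear qr_derivs
      has_vector_derivative_const | simp add: row_col_simps)+

text \<open>The products \<open>q_y r_y\<close> arising from \<open>q_y r - q r_y\<close> cancel.
  Multiplying by \<open>k\<close> clears the fraction in \<open>psi_t\<close>.\<close>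

lemma pdy_psi_t:
  "k * pdy (\<lambda>y t. psi_t \<gamma> \<delta> k q r y t \<psi> \<phi>) y t =
     (\<gamma> + \<delta>) * (pdy q y t \<odot> \<phi> 1)
     - (\<gamma> + \<delta>) * (pdy (pdy q) y t \<odot> \<phi> 0
        - \<delta> * ((q y t \<odot> pdy r y t + pdy q y t \<odot> r y t) * (q y t \<odot> \<phi> 0)
               + (q y t \<odot> r y t) * (pdy q y t \<odot> \<phi> 0)))
     - \<delta> * (pdy (pdy q) y t \<odot> r y t - q y t \<odot> pdy (pdy r) y t
        + 2 * (\<gamma> - \<delta>) * (q y t \<odot> r y t) * (q y t \<odot> pdy r y t + pdy q y t \<odot> r y t)) * \<psi>"
proof -
  have "pdy (\<lambda>y t. psi_t \<gamma> \<delta> k q r y t \<psi> \<phi>) y t = (1 / k) *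
     ((\<gamma> + \<delta>) * (pdy q y t \<odot> \<phi> 1)
     - (\<gamma> + \<delta>) * (pdy (pdy q) y t \<odot> \<phi> 0
        - \<delta> * ((q y t \<odot> pdy r y t + pdy q y t \<odot> r y t) * (q y t \<odot> \<phi> 0)
               + (q y t \<odot> r y t) * (pdy q y t \<odot> \<phi> 0)))
     - \<delta> * (pdy (pdy q) y t \<odot> r y t - q y t \<odot> pdy (pdy r) y t
        + 2 * (\<gamma> - \<delta>) * (q y t \<odot> r y t) * (q y t \<odot> pdy r y t + pdy q y t \<odot> r y t)) * \<psi>)"
    unfolding psi_t_def power2_eq_square
    by (rule pdy_eqI, rule has_vector_derivative_eq_rhs)
      (rule derivative_intros has_vector_derivative_bilinear qr_derivs
        has_vector_derivative_const | simp add: row_col_simps algebra_simps)+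
  then show ?thesis
    using k by simp
qed

section \<open>Evaluation of the two compatibility conditions\<close>

lemma psi_t_alt:
  "k * psi_t \<gamma> \<delta> k q r y t \<psi> \<phi> = (\<gamma> + \<delta>) * (q y t \<odot> \<phi> 1)
     - (\<gamma> + \<delta>) * (pdy q y t \<odot> \<phi> 0 - \<delta> * (q y t \<odot> r y t) * (q y t \<odot> \<phi> 0))
     - \<delta> * ((pdy q y t \<odot> r y t - q y t \<odot> pdy r y t) + (\<gamma> - \<delta>) * (q y t \<odot> r y t)\<^sup>2) * \<psi>"
  using k by (simp add: psi_t_def row_col_simps)

text \<open>The coefficients of \<open>phi_cur\<close> are constant, so each \<open>total_y\<close>
  merely shifts the derivative index and \<open>P\<close> drops out.\<close>

lemma phi_evolution_phi_cur:
  "k *s phi_evolution P \<gamma> \<delta> k v phi_cur y t \<psi> \<phi> = \<phi> 2 + (\<gamma> + \<delta>) *s (v y t *v \<phi> 0)"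
  using k by (simp add: phi_evolution_def total_y_def phi_cur_def pdy_const eval_nat_numeral)

text \<open>Both sides contain \<open>(\<gamma> + \<delta>) q \<phi>_yy\<close>. The two terms in
  \<open>q_y \<phi>_y\<close> cancel within the y-derivative of \<open>Q\<close>, and those in
  \<open>\<delta> (q r) (q \<phi>_y)\<close> cancel between the two sides.\<close>

lemma psi_condition:
  fixes y t \<psi> \<phi> v
  defines "P \<equiv> psi_y \<gamma> \<delta> q r" and "Q \<equiv> psi_t \<gamma> \<delta> k q r"
  defines "F \<equiv> phi_evolution P \<gamma> \<delta> k v phi_cur"
  shows "k * (total_t P Q F P y t \<psi> \<phi> - total_y P Q y t \<psi> \<phi>) =
    (\<gamma> + \<delta>) * (q_coeff \<gamma> \<delta> k q r v y t \<odot> \<phi> 0) + \<delta> * qr_coeff \<gamma> \<delta> k q r y t * \<psi>"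
proof -
  have qF: "k * (q y t \<odot> F y t \<psi> \<phi>) = q y t \<odot> \<phi> 2 + (\<gamma> + \<delta>) * ((q y t v* v y t) \<odot> \<phi> 0)"
    unfolding row_col_smult_right[symmetric] F_def phi_evolution_phi_cur
    by (simp add: row_col_simps row_col_matrix_vector)
  \<comment> \<open>\<open>P\<close> contains no y-derivative of \<open>\<phi>\<close>, so of the
    iterates in \<open>total_t\<close> only the zeroth, \<open>F\<close> itself, occurs.\<close>
  have t: "k * total_t P Q F P y t \<psi> \<phi> = k * pdt (\<lambda>y t. P y t \<psi> \<phi>) y t
      + (\<gamma> + \<delta>) * (k * (q y t \<odot> F y t \<psi> \<phi>)) + \<delta> * (q y t \<odot> r y t) * (k * Q y t \<psi> \<phi>)"
    unfolding total_t_def P_def pdt_psi_y unfolding psi_y_alt by (simp add: algebra_simps)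
  have y: "k * total_y P Q y t \<psi> \<phi> = k * pdy (\<lambda>y t. Q y t \<psi> \<phi>) y t
      + k * Q y t (P y t \<psi> \<phi>) (\<lambda>j. \<phi> (Suc j))"
    by (simp add: total_y_def algebra_simps)
  show ?thesis
    unfolding right_diff_distrib t y qF
    unfolding P_def Q_def psi_t_alt pdt_psi_y pdy_psi_t
    unfolding psi_y_alt q_coeff_def qr_coeff_def
    by (simp add: row_col_simps eval_nat_numeral algebra_simps power2_eq_square)
qed

text \<open>\<open>\<phi>_yy\<close> cancels between \<open>F\<close> and \<open>F_next\<close>, and
  \<open>(q \<phi>_y) r\<close> between \<open>Q r\<close> and the second y-derivative of
  \<open>\<psi> r\<close>. The terms \<open>(q_y \<phi>) r\<close> from these two sources add up,
  which yields one of the factors 2 in \<open>v_coeff\<close>.\<close>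

lemma phi_condition:
  fixes y t \<psi> \<phi> v v'
  defines "P \<equiv> psi_y \<gamma> \<delta> q r" and "Q \<equiv> psi_t \<gamma> \<delta> k q r"
  defines "F \<equiv> phi_evolution P \<gamma> \<delta> k v phi_cur"
    and "F_next \<equiv> phi_evolution P \<gamma> \<delta> k v' (phi_next r)"
  shows "k *s (total_t P Q F (\<lambda>y t \<psi> \<phi>. \<psi> *s r y t + phi_cur y t \<psi> \<phi>) y t \<psi> \<phi> - F_next y t \<psi> \<phi>) =
    \<psi> *s r_coeff \<gamma> \<delta> k q r v' y t - (\<gamma> + \<delta>) *s (v_coeff q r v v' y t *v \<phi> 0)"
proof -
  have pdt_X: "pdt (\<lambda>y t. \<psi> *s r y t + phi_cur y t \<psi> \<phi>) y t = \<psi> *s pdt r y t"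
    unfolding phi_cur_def
    by (rule pdt_eqI, rule has_vector_derivative_eq_rhs)
      (rule derivative_intros has_vector_derivative_bilinear qr_derivs
        has_vector_derivative_const | simp)+
  have t: "k *s total_t P Q F (\<lambda>y t \<psi> \<phi>. \<psi> *s r y t + phi_cur y t \<psi> \<phi>) y t \<psi> \<phi> =
      (k * \<psi>) *s pdt r y t + (k * Q y t \<psi> \<phi>) *s r y t + k *s F y t \<psi> \<phi>"
    unfolding total_t_def pdt_X
    by (simp add: phi_cur_def vector_add_ldistrib vector_smult_assoc add_ac)
  have "pdy (\<lambda>y t. phi_next r y t \<psi> \<phi>) y t = \<psi> *s pdy r y t" for y t \<psi> \<phi>
    unfolding phi_next_def
    by (rule pdy_eqI, rule has_vector_derivative_eq_rhs)
      (rule derivative_intros has_vector_derivative_bilinear qr_derivs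
        has_vector_derivative_const | simp)+
  then have y: "total_y P (phi_next r) = (\<lambda>y t \<psi> \<phi>. \<psi> *s pdy r y t + \<phi> 1 + P y t \<psi> \<phi> *s r y t)"
    by (simp add: total_y_def fun_eq_iff phi_next_def)
  note hP = has_vector_derivative_psi_y[folded P_def]
  have yy: "pdy (\<lambda>y t. \<psi> *s pdy r y t + \<phi> 1 + P y t \<psi> \<phi> *s r y t) y t =
      \<psi> *s pdy (pdy r) y t + P y t \<psi> \<phi> *s pdy r y t
      + ((\<gamma> + \<delta>) * (pdy q y t \<odot> \<phi> 0) + \<delta> * (q y t \<odot> pdy r y t + pdy q y t \<odot> r y t) * \<psi>) *s r y t"
    by (rule pdy_eqI, rule has_vector_derivative_eq_rhs)
      (rule derivative_intros has_vector_derivative_bilinear qr_derivs hP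
        has_vector_derivative_const | simp)+
  \<comment> \<open>\<open>P r_y\<close> occurs twice: once from differentiating the coefficient in
    \<open>P r\<close>, once from replacing \<open>\<psi>\<close> by \<open>P\<close> in
    \<open>\<psi> r_y\<close>. This is the other factor 2 in \<open>v_coeff\<close>.\<close>
  have F_next: "k *s F_next y t \<psi> \<phi> =
      \<psi> *s pdy (pdy r) y t + P y t \<psi> \<phi> *s pdy r y t
      + ((\<gamma> + \<delta>) * (pdy q y t \<odot> \<phi> 0) + \<delta> * (q y t \<odot> pdy r y t + pdy q y t \<odot> r y t) * \<psi>) *s r y t
      + P y t \<psi> \<phi> *s pdy r y t + \<phi> 2 + P y t (P y t \<psi> \<phi>) (\<lambda>j. \<phi> (Suc j)) *s r y t
      + (\<gamma> + \<delta>) *s (v' y t *v \<phi> 0 + \<psi> *s (v' y t *v r y t))"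
    using k unfolding F_next_def phi_evolution_def y
    unfolding total_y_def yy
    by (simp add: vector_smult_assoc phi_next_def matrix_vector_right_distrib vector_scalar_commute
        eval_nat_numeral add_ac)
  have N: "v_coeff q r v v' y t *v \<phi> 0 = v' y t *v \<phi> 0 - v y t *v \<phi> 0
      + 2 *s ((pdy q y t \<odot> \<phi> 0) *s r y t + (q y t \<odot> \<phi> 0) *s pdy r y t)"
    by (simp add: v_coeff_def matrix_vector_mult_add_rdistrib matrix_vector_mult_diff_rdistrib
        scaleR_2_matrix_vector col_row_matrix_vector vec_eq_iff)
  show ?thesis
    unfolding vector_ssub_ldistrib t F_next N
    unfolding F_def phi_evolution_phi_cur Q_def psi_t_alt
    unfolding P_def psi_y_alt r_coeff_def
    by (simp add: vec_eq_iff row_col_simps eval_nat_numeral algebra_simps power2_eq_square)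
qed

end

section \<open>Equivalence with the evolution equations\<close>

text \<open>Independence of \<open>\<psi>\<^sub>n\<close> and \<open>\<phi>\<^sub>n\<close>: unit
  vectors with \<open>\<psi> = 0\<close> read off the entries of \<open>a\<close>, and
  \<open>\<phi> = 0\<close>, \<open>\<psi> = 1\<close> reads off \<open>b\<close>.\<close>

lemma row_col_affine_zero_iff:
  fixes a :: "'a::field ^ 'm"
  assumes "c \<noteq> 0"
  shows "(\<forall>\<psi> (\<phi> :: nat \<Rightarrow> 'a ^ 'm). c * (a \<odot> \<phi> 0) + b * \<psi> = 0) \<longleftrightarrow> a = 0 \<and> b = 0"
proof safe
  assume *: "\<forall>\<psi> (\<phi> :: nat \<Rightarrow> 'a ^ 'm). c * (a \<odot> \<phi> 0) + b * \<psi> = 0"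
  show "a = 0"
    using *[rule_format, of "\<lambda>_. axis _ 1" 0] assms by (simp add: vec_eq_iff row_col_axis)
  show "b = 0"
    using *[rule_format, of "\<lambda>_. 0" 1] by (simp add: row_col_simps)
qed (simp add: row_col_simps)

lemma matrix_vector_affine_zero_iff:
  fixes A :: "'a::field ^ 'm ^ 'm"
  assumes "c \<noteq> 0"
  shows "(\<forall>\<psi> (\<phi> :: nat \<Rightarrow> 'a ^ 'm). \<psi> *s b - c *s (A *v \<phi> 0) = 0) \<longleftrightarrow> A = 0 \<and> b = 0"
proof safe
  assume *: "\<forall>\<psi> (\<phi> :: nat \<Rightarrow> 'a ^ 'm). \<psi> *s b - c *s (A *v \<phi> 0) = 0"
  have "A *v x = 0" for x
    using *[rule_format, of 0 "\<lambda>_. x"] assms by (simp add: vec_eq_iff)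
  then show "A = 0"
    by (simp add: matrix_eq)
  show "b = 0"
    using *[rule_format, of 1 "\<lambda>_. 0"] by simp
qed simp

lemma qr_coeff_eq_0:
  assumes "q_coeff \<gamma> \<delta> k q r v y t = 0" and "r_coeff \<gamma> \<delta> k q r v' y t = 0"
    and "v_coeff q r v v' y t = 0"
  shows "qr_coeff \<gamma> \<delta> k q r y t = 0"
proof -
  have "q y t \<odot> (v_coeff q r v v' y t *v r y t) = 0"
    by (simp add: assms(3) row_col_simps)
  then have N: "q y t \<odot> (v' y t *v r y t) - q y t \<odot> (v y t *v r y t)
      + 2 * ((q y t \<odot> r y t) * (pdy q y t \<odot> r y t) + (q y t \<odot> r y t) * (q y t \<odot> pdy r y t)) = 0"
    by (simp add: v_coeff_def matrix_vector_mult_add_rdistrib matrix_vector_mult_diff_rdistrib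
        scaleR_2_matrix_vector col_row_matrix_vector row_col_simps mult_ac)
  have "q_coeff \<gamma> \<delta> k q r v y t \<odot> r y t = 0"
    by (simp add: assms(1) row_col_simps)
  then have E1: "k * (pdt q y t \<odot> r y t) + pdy (pdy q) y t \<odot> r y t
      + (\<gamma> + \<delta>) * (q y t \<odot> (v y t *v r y t))
      - 2 * \<delta> * ((q y t \<odot> r y t) * (pdy q y t \<odot> r y t) + (q y t \<odot> pdy r y t) * (q y t \<odot> r y t))
      + \<gamma> * \<delta> * (q y t \<odot> r y t)\<^sup>2 * (q y t \<odot> r y t) = 0"
    by (simp add: q_coeff_def row_col_simps row_col_matrix_vector algebra_simps)
  have "q y t \<odot> r_coeff \<gamma> \<delta> k q r v' y t = 0"
    by (simp add: assms(2) row_col_simps)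
  then have E2: "k * (q y t \<odot> pdt r y t) - q y t \<odot> pdy (pdy r) y t
      - (\<gamma> + \<delta>) * (q y t \<odot> (v' y t *v r y t))
      - 2 * \<delta> * ((q y t \<odot> r y t) * (q y t \<odot> pdy r y t) + (pdy q y t \<odot> r y t) * (q y t \<odot> r y t))
      - \<gamma> * \<delta> * (q y t \<odot> r y t)\<^sup>2 * (q y t \<odot> r y t) = 0"
    by (simp add: r_coeff_def row_col_simps algebra_simps)
  \<comment> \<open>The goal is \<open>E1 + E2 + (\<gamma> + \<delta>) N\<close>: the cubes of
    \<open>q r\<close> and the \<open>v\<close> terms cancel, and \<open>2 (\<gamma> + \<delta>) - 4
    \<delta> = 2 (\<gamma> - \<delta>)\<close>.\<close>
  show ?thesis
    using N E1 E2 unfolding qr_coeff_def by algebra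
qed

text \<open>Write \<open>\<gamma> v + \<delta> v' = (\<gamma> + \<delta>) v + \<delta> (v' -
  v)\<close>; the last term, multiplied by \<open>q\<close> from the left, supplies the summand with
  factor \<open>- 2 \<delta>\<close> in \<open>q_coeff\<close>.\<close>

lemma q_coeff_eq:
  assumes "v_coeff q r v v' y t = 0"
  shows "q_coeff \<gamma> \<delta> k q r v y t = k *s pdt q y t + pdy (pdy q) y t
    + q y t v* (mat \<gamma> ** v y t + mat \<delta> ** v' y t) + (\<gamma> * \<delta> * (q y t \<odot> r y t)\<^sup>2) *s q y t"
proof -
  have v': "v' y t = v y t - 2 *\<^sub>R (col_row (r y t) (pdy q y t) + col_row (pdy r y t) (q y t))"
    using assms by (simp add: v_coeff_def algebra_simps eq_neg_iff_add_eq_0)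
  have qv': "q y t v* v' y t = q y t v* v y t
      - 2 *s ((q y t \<odot> r y t) *s pdy q y t + (q y t \<odot> pdy r y t) *s q y t)"
    by (simp add: v' vector_matrix_mult_diff_rdistrib vector_matrix_mult_add_rdistrib
        vector_matrix_scaleR_2 vector_matrix_col_row del: scaleR_right_distrib)
  show ?thesis
    unfolding q_coeff_def vector_matrix_mult_add_rdistrib vector_matrix_mat_mult qv'
    by (simp add: vec_eq_iff algebra_simps)
qed

text \<open>Here the splitting is around the other site: \<open>\<delta> v + \<gamma> v' = (\<gamma>
  + \<delta>) v' + \<delta> (v - v')\<close>.\<close>

lemma r_coeff_eq:
  assumes "v_coeff q r v v' y t = 0"
  shows "r_coeff \<gamma> \<delta> k q r v' y t = k *s pdt r y t - pdy (pdy r) y t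
    - (mat \<delta> ** v y t + mat \<gamma> ** v' y t) *v r y t - (\<gamma> * \<delta> * (q y t \<odot> r y t)\<^sup>2) *s r y t"
proof -
  have v: "v y t = v' y t + 2 *\<^sub>R (col_row (r y t) (pdy q y t) + col_row (pdy r y t) (q y t))"
    using assms by (simp add: v_coeff_def algebra_simps)
  have vr: "v y t *v r y t = v' y t *v r y t
      + 2 *s ((pdy q y t \<odot> r y t) *s r y t + (q y t \<odot> r y t) *s pdy r y t)"
    by (simp add: v matrix_vector_mult_add_rdistrib scaleR_2_matrix_vector col_row_matrix_vector
        del: scaleR_right_distrib)
  show ?thesis
    unfolding r_coeff_def matrix_vector_mult_add_rdistrib mat_mult_matrix_vector vr
    by (simp add: vec_eq_iff algebra_simps)
qed

theorem proposition2p5: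
  fixes \<gamma> \<delta> k :: "'a::real_normed_field"
    and q r :: "int \<Rightarrow> real \<Rightarrow> real \<Rightarrow> 'a ^ 'm"
    and v :: "int \<Rightarrow> real \<Rightarrow> real \<Rightarrow> 'a ^ 'm ^ 'm"
  assumes "\<gamma> + \<delta> \<noteq> 0" and "k \<noteq> 0"
    and "\<And>n. smooth (q n)" and "\<And>n. smooth (r n)" and "\<And>n. smooth (v n)"
  shows "compatible \<gamma> \<delta> k q r v \<longleftrightarrow>
    (\<forall>n y t.
      k *s pdt (q n) y t + pdy (pdy (q n)) y t
        + q n y t v* (mat \<gamma> ** v n y t + mat \<delta> ** v (n + 1) y t)
        + (\<gamma> * \<delta> * (q n y t \<odot> r n y t)\<^sup>2) *s q n y t = 0 \<and>
      k *s pdt (r n) y t - pdy (pdy (r n)) y t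
        - (mat \<delta> ** v n y t + mat \<gamma> ** v (n + 1) y t) *v r n y t
        - (\<gamma> * \<delta> * (q n y t \<odot> r n y t)\<^sup>2) *s r n y t = 0 \<and>
      v (n + 1) y t - v n y t = (- 2) *\<^sub>R pdy (\<lambda>y t. col_row (r n y t) (q n y t)) y t)"
    (is "_ \<longleftrightarrow> (\<forall>n y t. ?q n y t = 0 \<and> ?r n y t = 0 \<and> ?v n y t)")
proof -
  \<comment> \<open>Brings the pair of conditions into the form, multiplied by \<open>k\<close>, in
    which they were evaluated.\<close>
  have scale: "(a = b \<and> x = 0) \<longleftrightarrow> (k * (a - b) = 0 \<and> k *s x = 0)" for a b and x :: "'a ^ 'm"
    using \<open>k \<noteq> 0\<close> by (auto simp: vec_eq_iff)
  have v_iff: "?v n y t \<longleftrightarrow> v_coeff (q n) (r n) (v n) (v (n + 1)) y t = 0" for n y t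
  proof -
    have "pdy (\<lambda>y t. col_row (r n y t) (q n y t)) y t =
        col_row (r n y t) (pdy (q n) y t) + col_row (pdy (r n) y t) (q n y t)"
      by (intro pdy_eqI has_vector_derivative_col_row smooth_has_pdy assms)
    then show ?thesis
      by (simp add: v_coeff_def eq_neg_iff_add_eq_0)
  qed
  have "compatible \<gamma> \<delta> k q r v \<longleftrightarrow> (\<forall>n y t.
      q_coeff \<gamma> \<delta> k (q n) (r n) (v n) y t = 0 \<and> \<delta> * qr_coeff \<gamma> \<delta> k (q n) (r n) y t = 0 \<and>
      v_coeff (q n) (r n) (v n) (v (n + 1)) y t = 0 \<and> r_coeff \<gamma> \<delta> k (q n) (r n) (v (n + 1)) y t = 0)"
    unfolding compatible_def Let_def scale[of "total_t _ _ _ _ _ _ _ _"]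
    unfolding psi_condition[OF assms(2-4)] phi_condition[OF assms(2-4)]
      all_conj_distrib row_col_affine_zero_iff[OF assms(1)] matrix_vector_affine_zero_iff[OF assms(1)]
    by blast
  also have "\<dots> \<longleftrightarrow> (\<forall>n y t. ?q n y t = 0 \<and> ?r n y t = 0 \<and> ?v n y t)"
    \<comment> \<open>The equation for \<open>v\<close> stands on both sides and licenses rewriting
      the other two; the conjunct with \<open>qr_coeff\<close> then follows from the rest.\<close>
    unfolding v_iff using q_coeff_eq r_coeff_eq qr_coeff_eq_0 by (metis mult_zero_right)
  finally show ?thesis .
qed

end
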